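(* Let $D>0$ and $\epsilon\in(0,1)$. An off-line policy is a deterministic (measurable) function $u:[0,\infty)\to\{0,1\}$ of time. In order to find a minimum-cost $(D,\epsilon)$-feasible off-line policy it is sufficient to consider policies of the form $$u_t=\begin{cases}1,& t\le t_s,\\ 0,& t>t_s.\end{cases}$$ That is, for every $(D,\epsilon)$-feasible off-line policy $\pi$ there is $t_s\in[0,\infty]$ such that the off-line policy $\pi'$ given by $u_t=1$ for $t\le t_s$ and $u_t=0$ for $t>t_s$ is $(D,\epsilon)$-feasible and has cost no larger than the cost of $\pi$.
   Context: Media streaming model with infinite file size. Let $R_0>1$, $R_c>0$, $R_1=R_0+R_c$. Let $N_t$ and $N^c_t$ be independent Poisson processes of rates $R_0$ (free server) and $R_c$ (costly server). With initial buffer size $D$ and actions $u_t\in\{0,1\}$ ($u_t=1$ if both servers are used at time $t$, $u_t=0$ if only the free one is used), the buffer size is $$x_t = D+N_t+\int_0^t u_\tau\, dN^c_\tau - t .$$ The interruption probability of a policy $\pi$ is $p^\pi(D)=\mathbf P\{\exists\, t\ge 0:\ x_t\le 0\}$. The policy is $(D,\epsilon)$-feasible if $p^\pi(D)\le\epsilon$. The cost of a $(D,\epsilon)$-feasible policy is $J^\pi(D,\epsilon)=\mathbf E\big[\int_0^\infty u_t\,dt\big]\in[0,\infty]$. *)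

theory Defs
  imports "HOL-Probability.Probability"
begin

text \<open>
  A homogeneous Poisson process of rate \<open>r\<close>, indexed by the times \<open>t \<ge> 0\<close>; the values at
  negative times are irrelevant. Its paths are counting paths: they start at 0 and are
  nondecreasing and right-continuous, for every outcome and not just almost surely.
\<close>

definition poisson_process :: "'a measure \<Rightarrow> real \<Rightarrow> (real \<Rightarrow> 'a \<Rightarrow> nat) \<Rightarrow> bool" where
  "poisson_process M r N \<longleftrightarrow>
     prob_space M \<and> 0 < r \<and>
     (\<forall>t\<ge>0. N t \<in> measurable M (count_space UNIV)) \<and>
     (\<forall>\<omega>\<in>space M. N 0 \<omega> = 0 \<and> mono_on {0..} (\<lambda>t. N t \<omega>) \<and>
        (\<forall>t\<ge>0. continuous (at_right t) (\<lambda>s. real (N s \<omega>)))) \<and>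
     (\<forall>s t. 0 \<le> s \<longrightarrow> s < t \<longrightarrow>
        distr M (count_space UNIV) (\<lambda>\<omega>. N t \<omega> - N s \<omega>) = measure_pmf (poisson_pmf (r * (t - s)))) \<and>
     (\<forall>(n::nat) (t::nat \<Rightarrow> real). 0 \<le> t 0 \<longrightarrow> (\<forall>i<n. t i \<le> t (Suc i)) \<longrightarrow>
        prob_space.indep_vars M (\<lambda>_. count_space UNIV)
          (\<lambda>i \<omega>. N (t (Suc i)) \<omega> - N (t i) \<omega>) {..<n})"

definition independent_processes ::
    "'a measure \<Rightarrow> (real \<Rightarrow> 'a \<Rightarrow> nat) \<Rightarrow> (real \<Rightarrow> 'a \<Rightarrow> nat) \<Rightarrow> bool" where
  "independent_processes M X Y \<longleftrightarrow>
     prob_space.indep_var M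
       (PiM {0..} (\<lambda>_. count_space UNIV)) (\<lambda>\<omega>. \<lambda>t\<in>{0..}. X t \<omega>)
       (PiM {0..} (\<lambda>_. count_space UNIV)) (\<lambda>\<omega>. \<lambda>t\<in>{0..}. Y t \<omega>)"

text \<open>
  The buffer size under an action process \<open>u\<close>. The integral against the path of \<open>Nc\<close> is the
  pathwise Lebesgue--Stieltjes integral; \<open>max 0 \<tau>\<close> extends the path by its value at time 0
  to negative times, so that the induced measure has no mass at or below 0.
\<close>

definition buffer ::
    "(real \<Rightarrow> 'a \<Rightarrow> nat) \<Rightarrow> (real \<Rightarrow> 'a \<Rightarrow> nat) \<Rightarrow> real \<Rightarrow> (real \<Rightarrow> 'a \<Rightarrow> real) \<Rightarrow> real \<Rightarrow> 'a \<Rightarrow> real" where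
  "buffer N Nc D u t \<omega> =
     D + real (N t \<omega>)
       + (\<integral>\<tau>\<in>{0..t}. u \<tau> \<omega> \<partial>interval_measure (\<lambda>\<tau>. real (Nc (max 0 \<tau>) \<omega>))) - t"

text \<open>
  For an off-line policy the interruption event is measurable: between jumps of the driving
  processes the buffer decreases, so the time \<open>t\<close> below can be taken rational.
\<close>

definition interruption_prob ::
    "'a measure \<Rightarrow> (real \<Rightarrow> 'a \<Rightarrow> nat) \<Rightarrow> (real \<Rightarrow> 'a \<Rightarrow> nat) \<Rightarrow> (real \<Rightarrow> 'a \<Rightarrow> real) \<Rightarrow> real \<Rightarrow> real" where
  "interruption_prob M N Nc u D = measure M {\<omega>\<in>space M. \<exists>t\<ge>0. buffer N Nc D u t \<omega> \<le> 0}"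

definition feasible ::
    "'a measure \<Rightarrow> (real \<Rightarrow> 'a \<Rightarrow> nat) \<Rightarrow> (real \<Rightarrow> 'a \<Rightarrow> nat) \<Rightarrow> real \<Rightarrow> real \<Rightarrow> (real \<Rightarrow> 'a \<Rightarrow> real) \<Rightarrow> bool" where
  "feasible M N Nc D \<epsilon> u \<longleftrightarrow> interruption_prob M N Nc u D \<le> \<epsilon>"

definition cost :: "'a measure \<Rightarrow> (real \<Rightarrow> 'a \<Rightarrow> real) \<Rightarrow> ennreal" where
  "cost M u = (\<integral>\<^sup>+\<omega>. (\<integral>\<^sup>+t\<in>{0..}. ennreal (u t \<omega>) \<partial>lborel) \<partial>M)"

text \<open>
  A deterministic action function \<open>u\<close> enters the definitions above as the process \<open>\<lambda>t _. u t\<close>.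
\<close>

definition offline_policy :: "(real \<Rightarrow> real) \<Rightarrow> bool" where
  "offline_policy u \<longleftrightarrow>
     u \<in> borel_measurable (restrict_space borel {0..}) \<and> (\<forall>t\<ge>0. u t \<in> {0, 1})"

definition threshold :: "ereal \<Rightarrow> real \<Rightarrow> real" where
  "threshold ts t = (if ereal t \<le> ts then 1 else 0)"

end

theory Submission
  imports Defs
begin

text \<open>
  Let \<open>A\<close> be the set of times at which the policy uses the costly server, and let \<open>ts\<close> be its
  Lebesgue measure, which is the cost. Thinning the Poisson process of the costly server to \<open>A\<close>
  has the same law as running it with the clock \<open>m t\<close>, the Lebesgue measure of the part of \<open>A\<close>
  in \<open>(0, t]\<close>. The threshold policy runs the same process with the clock \<open>min t ts\<close>, which is
  at least \<open>m t\<close>, so its buffer is pathwise larger.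

  The identity of laws is elementary when \<open>A\<close> is a union of dyadic cells of a fixed grid, and a
  Borel set \<open>A\<close> is approximated by such unions \<open>E\<close>: the expected number of points in a set is
  the rate times its Lebesgue measure, so by Markov's inequality the thinnings to \<open>A\<close> and \<open>E\<close>
  agree up to any given time with probability close to 1.
\<close>

subsection \<open>The measure of the jumps of a counting path\<close>

definition counting_path :: "(real \<Rightarrow> nat) \<Rightarrow> bool" where
  "counting_path f \<longleftrightarrow>
     f 0 = 0 \<and> mono_on {0..} f \<and> (\<forall>t\<ge>0. continuous (at_right t) (\<lambda>s. real (f s)))"

text \<open>For a fixed outcome this is the integrator that occurs in \<open>buffer\<close>: it puts
  on each jump time a mass equal to the size of the jump.\<close>

definition jump_measure :: "(real \<Rightarrow> nat) \<Rightarrow> real measure" where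
  "jump_measure f = interval_measure (\<lambda>t. real (f (max 0 t)))"

lemma sets_jump_measure [simp, measurable_cong]: "sets (jump_measure f) = sets borel"
  by (simp add: jump_measure_def)

lemma space_jump_measure [simp]: "space (jump_measure f) = UNIV"
  by (simp add: jump_measure_def)

text \<open>The pi-lambda theorem for the generator of closed left rays, which is stable under
  intersection. It serves for the integrality of counts, for their means, and for the dyadic
  approximation.\<close>

lemma borel_real_induct [consumes 1, case_names atMost empty compl union]:
  fixes B :: "real set"
  assumes "B \<in> sets borel"
    and "\<And>a. P {..a}" and "P {}"
    and "\<And>B. B \<in> sets borel \<Longrightarrow> P B \<Longrightarrow> P (- B)"
    and "\<And>B. disjoint_family B \<Longrightarrow> (\<And>i. B i \<in> sets borel) \<Longrightarrow> (\<And>i. P (B i)) \<Longrightarrow> P (\<Union>i::nat. B i)"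
  shows "P B"
proof -
  have borel: "sets borel = sigma_sets UNIV (range (\<lambda>a::real. {..a}))"
    by (subst borel_eq_atMost) simp
  have "Int_stable (range (\<lambda>a::real. {..a}))"
    by (auto simp: Int_stable_def)
  moreover have "range (\<lambda>a::real. {..a}) \<subseteq> Pow UNIV" by simp
  moreover note assms(1)[unfolded borel]
  ultimately show ?thesis
  proof (induction rule: sigma_sets_induct_disjoint)
    case (compl B)
    then show ?case using assms(4)[of B] by (simp add: borel Compl_eq_Diff_UNIV)
  next
    case (union B)
    then show ?case by (intro assms(5)) (auto simp: borel)
  qed (use assms in auto)
qed

text \<open>Right-continuity brings the values within distance less than 1 of \<open>f t\<close>,
  and natural numbers that close are equal.\<close>

lemma counting_path_eventually_const:
  assumes f: "counting_path f" and t: "0 \<le> t"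
  shows "\<exists>d>0. \<forall>s. t \<le> s \<longrightarrow> s < t + d \<longrightarrow> f s = f t"
proof -
  have "((\<lambda>s. real (f s)) \<longlongrightarrow> real (f t)) (at_right t)"
    using f t by (simp add: counting_path_def continuous_within)
  then have "\<forall>\<^sub>F s in at_right t. dist (real (f s)) (real (f t)) < 1"
    by (rule tendstoD) simp
  then obtain b where b: "b > t" "\<And>s. t < s \<Longrightarrow> s < b \<Longrightarrow> dist (real (f s)) (real (f t)) < 1"
    by (auto simp: eventually_at_right_field)
  have "f s = f t" if "t \<le> s" "s < t + (b - t)" for s
    using b(2)[of s] that by (cases "s = t") (auto simp: dist_real_def)
  moreover have "0 < b - t" using b(1) by simp
  ultimately show ?thesis by blast
qed

text \<open>Extending the path by its value at 0 makes it nondecreasing and right-continuous on the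
  whole line, as the formula for interval measures requires. That 0 carries no mass later allows
  \<open>{0..t}\<close> to be exchanged for \<open>{0<..t}\<close>.\<close>

lemma
  assumes f: "counting_path f"
  shows emeasure_jump_measure_Ioc: "0 \<le> a \<Longrightarrow> a \<le> b \<Longrightarrow>
      emeasure (jump_measure f) {a<..b} = ennreal (real (f b) - real (f a))"
    and measure_jump_measure_Ioc: "0 \<le> a \<Longrightarrow> a \<le> b \<Longrightarrow>
      measure (jump_measure f) {a<..b} = real (f b) - real (f a)"
    and emeasure_jump_measure_zero: "emeasure (jump_measure f) {0} = 0"
proof -
  have mono: "real (f (max 0 x)) \<le> real (f (max 0 y))" if "x \<le> y" for x y
    using f that by (auto simp: counting_path_def intro!: mono_onD[of "{0..}" f])
  have cont: "continuous (at_right a) (\<lambda>t. real (f (max 0 t)))" for a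
  proof (cases "0 \<le> a")
    case True
    then have "((\<lambda>s. real (f s)) \<longlongrightarrow> real (f a)) (at_right a)"
      using f by (simp add: counting_path_def continuous_within)
    moreover have "\<forall>\<^sub>F s in at_right a. real (f s) = real (f (max 0 s))"
      using True by (auto simp: eventually_at_right_field intro!: exI[of _ "a + 1"])
    ultimately show ?thesis
      using True by (auto simp: continuous_within intro: Lim_transform_eventually)
  next
    case False
    \<comment> \<open>Between \<open>a\<close> and 0 the extended path is constant with value
      \<open>f 0\<close>.\<close>
    then have "\<forall>\<^sub>F s in at_right a. real (f 0) = real (f (max 0 s))"
      by (auto simp: eventually_at_right_field intro!: exI[of _ 0])
    with False show ?thesis
      by (auto simp: continuous_within intro: Lim_transform_eventually)
  qed
  show Ioc: "emeasure (jump_measure f) {a<..b} = ennreal (real (f b) - real (f a))"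
    if "0 \<le> a" "a \<le> b" for a b
    using emeasure_interval_measure_Ioc[of a b "\<lambda>t. real (f (max 0 t))"] that mono cont
    by (simp add: jump_measure_def)
  show "measure (jump_measure f) {a<..b} = real (f b) - real (f a)" if "0 \<le> a" "a \<le> b" for a b
    using Ioc[OF that] mono[of a b] that by (simp add: measure_def)
  have "emeasure (jump_measure f) {0} \<le> emeasure (jump_measure f) {-1<..0}"
    by (intro emeasure_mono) auto
  also have "\<dots> = 0"
    using emeasure_interval_measure_Ioc[of "-1" 0 "\<lambda>t. real (f (max 0 t))"] mono cont
    by (simp add: jump_measure_def)
  finally show "emeasure (jump_measure f) {0} = 0" by simp
qed

lemma emeasure_jump_measure_finite:
  assumes "counting_path f"
  shows "emeasure (jump_measure f) (B \<inter> {0<..K}) < \<infinity>"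
proof -
  have "emeasure (jump_measure f) (B \<inter> {0<..K}) \<le> emeasure (jump_measure f) {0<..max 0 K}"
    by (intro emeasure_mono) auto
  also have "\<dots> < \<infinity>" using assms by (simp add: emeasure_jump_measure_Ioc)
  finally show ?thesis .
qed

lemma emeasure_jump_measure_Ioc_finite:
  "counting_path f \<Longrightarrow> emeasure (jump_measure f) {0<..K} < \<infinity>"
  using emeasure_jump_measure_finite[of f UNIV K] by simp

lemma sum_Nats: "(\<And>i. i \<in> I \<Longrightarrow> g i \<in> \<nat>) \<Longrightarrow> sum g I \<in> \<nat>"
  by (induction I rule: infinite_finite_induct) auto

text \<open>Intervals have natural mass by the increment formula; complements inside the window give
  differences of naturals, and disjoint unions give limits of natural partial sums, which are
  natural because \<open>\<nat>\<close> is closed. The use is that a nonzero count is at least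
  1.\<close>

lemma measure_jump_measure_Nats:
  assumes f: "counting_path f" and B: "B \<in> sets borel"
  shows "measure (jump_measure f) (B \<inter> {0<..K}) \<in> \<nat>"
  using B
proof (induction rule: borel_real_induct)
  case (atMost a)
  have eq: "{..a} \<inter> {0<..K} = {0<..min a K}" by auto
  show ?case
  proof (cases "0 \<le> min a K")
    case True
    then show ?thesis using f unfolding eq
      by (subst measure_jump_measure_Ioc) (auto simp: counting_path_def)
  qed (auto simp: eq)
next
  case empty
  then show ?case by simp
next
  case (compl B)
  have "measure (jump_measure f) (- B \<inter> {0<..K}) =
      measure (jump_measure f) ({0<..K} - B \<inter> {0<..K})"
    by (rule arg_cong[where f = "measure _"]) auto
  also have "\<dots> = measure (jump_measure f) {0<..K} - measure (jump_measure f) (B \<inter> {0<..K})"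
    using emeasure_jump_measure_finite[OF f, of UNIV K] compl(1)
    by (intro measure_Diff) auto
  finally have eq: "measure (jump_measure f) (- B \<inter> {0<..K}) =
      measure (jump_measure f) {0<..K} - measure (jump_measure f) (B \<inter> {0<..K})" .
  have le: "measure (jump_measure f) (B \<inter> {0<..K}) \<le> measure (jump_measure f) {0<..K}"
    using emeasure_jump_measure_finite[OF f, of UNIV K] compl(1)
    by (intro measure_mono_fmeasurable) (auto simp: fmeasurable_def)
  have "measure (jump_measure f) {0<..K} \<in> \<nat>"
    using f by (cases "0 \<le> K") (auto simp: measure_jump_measure_Ioc counting_path_def)
  with compl(2) le show ?case unfolding eq by (intro Nats_diff) auto
next
  case (union B)
  have "(\<lambda>i. measure (jump_measure f) (B i \<inter> {0<..K})) sums
      measure (jump_measure f) (\<Union>i. B i \<inter> {0<..K})"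
    using union(1,2) emeasure_jump_measure_finite[OF f, of "\<Union>i. B i" K]
    by (intro measure_UNION) (auto simp: disjoint_family_on_def)
  then have lim: "(\<lambda>n. \<Sum>i<n. measure (jump_measure f) (B i \<inter> {0<..K})) \<longlonglongrightarrow>
      measure (jump_measure f) ((\<Union>i. B i) \<inter> {0<..K})"
    by (simp add: sums_def)
  show ?case
    by (rule closed_sequentially[OF closed_Nats _ lim]) (auto intro!: sum_Nats union(3))
qed

subsection \<open>Jumps of a Poisson process in a Borel set\<close>

lemma emeasure_lborel_Int_Ioc_finite: "emeasure lborel (B \<inter> {0<..K::real}) < \<infinity>"
proof -
  have "emeasure lborel (B \<inter> {0<..K}) \<le> emeasure lborel {0..max 0 K}"
    by (intro emeasure_mono) auto
  also have "\<dots> < \<infinity>" by (subst emeasure_lborel_Icc) auto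
  finally show ?thesis .
qed

lemma emeasure_lborel_Ioc_finite: "emeasure lborel {0<..K::real} < \<infinity>"
  using emeasure_lborel_Int_Ioc_finite[of UNIV K] by simp

text \<open>The factor \<open>k\<close> cancels against \<open>fact k\<close>, leaving the
  exponential series shifted by one; the term at 0 vanishes, so shifting back changes
  nothing.\<close>

lemma nn_integral_poisson_pmf:
  assumes "0 < r"
  shows "(\<integral>\<^sup>+k. ennreal (real k) \<partial>measure_pmf (poisson_pmf r)) = ennreal r"
proof -
  have "(\<lambda>k. r * exp (-r) * (r ^ k /\<^sub>R fact k)) sums (r * exp (-r) * exp r)"
    by (intro sums_mult exp_converges)
  then have "(\<lambda>k. pmf (poisson_pmf r) (Suc k) * real (Suc k)) sums r"
    using assms by (simp add: field_simps exp_minus del: of_nat_Suc)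
  then have "(\<lambda>k. pmf (poisson_pmf r) k * real k) sums r"
    by (subst (asm) sums_Suc_iff) simp
  then show ?thesis
    by (simp only: nn_integral_measure_pmf nn_integral_count_space_nat
        ennreal_mult'[symmetric] pmf_nonneg mult_nonneg_nonneg of_nat_0_le_iff suminf_ennreal_eq)
qed

lemma poisson_process_counting_path:
  "poisson_process M r N \<Longrightarrow> \<omega> \<in> space M \<Longrightarrow> counting_path (\<lambda>t. N t \<omega>)"
  by (auto simp: poisson_process_def counting_path_def)

lemma poisson_process_measurable:
  "poisson_process M r N \<Longrightarrow> 0 \<le> t \<Longrightarrow> N t \<in> measurable M (count_space UNIV)"
  by (auto simp: poisson_process_def)

text \<open>\<open>N t\<close> is the increment from time 0. The law of increments is prescribed
  only for \<open>s < t\<close>, hence the separate case \<open>t = 0\<close>.\<close>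

lemma nn_integral_poisson_process:
  assumes N: "poisson_process M r N" and t: "0 \<le> t"
  shows "(\<integral>\<^sup>+\<omega>. ennreal (real (N t \<omega>)) \<partial>M) = ennreal (r * t)"
proof -
  have zero: "N 0 \<omega> = 0" if "\<omega> \<in> space M" for \<omega>
    using N that by (auto simp: poisson_process_def)
  show ?thesis
  proof (cases "t = 0")
    case True
    then show ?thesis by (simp add: zero cong: nn_integral_cong)
  next
    case False
    with t have t: "0 < t" by simp
    have r: "0 < r" using N by (auto simp: poisson_process_def)
    have [measurable]: "N t \<in> measurable M (count_space UNIV)" "N 0 \<in> measurable M (count_space UNIV)"
      using poisson_process_measurable[OF N] t by auto
    have "(\<integral>\<^sup>+\<omega>. ennreal (real (N t \<omega>)) \<partial>M) = (\<integral>\<^sup>+\<omega>. ennreal (real (N t \<omega> - N 0 \<omega>)) \<partial>M)"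
      by (intro nn_integral_cong) (simp add: zero)
    also have "\<dots> = (\<integral>\<^sup>+k. ennreal (real k) \<partial>distr M (count_space UNIV) (\<lambda>\<omega>. N t \<omega> - N 0 \<omega>))"
      by (subst nn_integral_distr) auto
    also have "\<dots> = ennreal (r * t)"
      using N t r by (simp add: poisson_process_def nn_integral_poisson_pmf)
    finally show ?thesis .
  qed
qed

text \<open>The mean measure of the process is \<open>r\<close> times Lebesgue measure. Both claims
  go through one induction, since the integrals of differences and series need measurability; the
  bounded window keeps all masses finite, so that they can be subtracted in
  \<open>ennreal\<close>.\<close>

lemma
  assumes N: "poisson_process M r N" and B: "B \<in> sets borel"
  shows measurable_emeasure_jump_measure:
      "(\<lambda>\<omega>. emeasure (jump_measure (\<lambda>t. N t \<omega>)) (B \<inter> {0<..K})) \<in> borel_measurable M" (is ?thesis1)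
    and nn_integral_emeasure_jump_measure:
      "(\<integral>\<^sup>+\<omega>. emeasure (jump_measure (\<lambda>t. N t \<omega>)) (B \<inter> {0<..K}) \<partial>M) =
        ennreal r * emeasure lborel (B \<inter> {0<..K})" (is ?thesis2)
proof -
  let ?\<kappa> = "\<lambda>B \<omega>. emeasure (jump_measure (\<lambda>t. N t \<omega>)) (B \<inter> {0<..K})"
  have r: "0 < r" using N by (auto simp: poisson_process_def)
  note path = poisson_process_counting_path[OF N]
  \<comment> \<open>For negative \<open>a\<close> the interval is empty, which agrees with the path
    being 0 at time \<open>max 0 a = 0\<close>.\<close>
  have Ioc: "emeasure (jump_measure (\<lambda>t. N t \<omega>)) {0<..a} = ennreal (real (N (max 0 a) \<omega>))"
    if "\<omega> \<in> space M" for a \<omega>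
    using path[OF that] by (cases "0 \<le> a") (auto simp: emeasure_jump_measure_Ioc counting_path_def)
  have Ioc_m: "(\<lambda>\<omega>. emeasure (jump_measure (\<lambda>t. N t \<omega>)) {0<..a}) \<in> borel_measurable M"
    and Ioc_i: "(\<integral>\<^sup>+\<omega>. emeasure (jump_measure (\<lambda>t. N t \<omega>)) {0<..a} \<partial>M) =
      ennreal r * emeasure lborel {0<..a}" for a
  proof -
    have [measurable]: "N (max 0 a) \<in> measurable M (count_space UNIV)"
      using poisson_process_measurable[OF N] by simp
    have "(\<lambda>\<omega>. ennreal (real (N (max 0 a) \<omega>))) \<in> borel_measurable M" by measurable
    then show "(\<lambda>\<omega>. emeasure (jump_measure (\<lambda>t. N t \<omega>)) {0<..a}) \<in> borel_measurable M"
      by (simp add: Ioc cong: measurable_cong)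
    show "(\<integral>\<^sup>+\<omega>. emeasure (jump_measure (\<lambda>t. N t \<omega>)) {0<..a} \<partial>M) =
      ennreal r * emeasure lborel {0<..a}"
      using nn_integral_poisson_process[OF N, of "max 0 a"] r
      by (cases "0 \<le> a") (simp_all add: Ioc ennreal_mult'[symmetric] cong: nn_integral_cong)
  qed
  have fin: "?\<kappa> B \<omega> \<noteq> \<infinity>" if "\<omega> \<in> space M" for B \<omega>
    using emeasure_jump_measure_finite[OF path[OF that], of B K] by simp
  from B have "?\<kappa> B \<in> borel_measurable M \<and>
    (\<integral>\<^sup>+\<omega>. ?\<kappa> B \<omega> \<partial>M) = ennreal r * emeasure lborel (B \<inter> {0<..K})"
  proof (induction rule: borel_real_induct)
    case (atMost a)
    have "{..a} \<inter> {0<..K} = {0<..min a K}" by auto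
    then show ?case using Ioc_m Ioc_i by simp
  next
    case empty
    then show ?case by simp
  next
    case (compl B)
    note [measurable] = compl(1)
    have lfin: "emeasure lborel (B \<inter> {0<..K}) \<noteq> \<infinity>"
      using emeasure_lborel_Int_Ioc_finite[of B K] by simp
    have B': "- B \<inter> {0<..K} = {0<..K} - B \<inter> {0<..K}" by auto
    have eq: "?\<kappa> (- B) \<omega> = emeasure (jump_measure (\<lambda>t. N t \<omega>)) {0<..K} - ?\<kappa> B \<omega>"
      if "\<omega> \<in> space M" for \<omega>
      unfolding B' using fin[OF that, of B] by (intro emeasure_Diff) auto
    have "?\<kappa> (- B) \<in> borel_measurable M"
      using Ioc_m compl(2) by (simp add: eq borel_measurable_minus_ennreal cong: measurable_cong)
    moreover have "(\<integral>\<^sup>+\<omega>. ?\<kappa> (- B) \<omega> \<partial>M) =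
      (\<integral>\<^sup>+\<omega>. emeasure (jump_measure (\<lambda>t. N t \<omega>)) {0<..K} - ?\<kappa> B \<omega> \<partial>M)"
      by (intro nn_integral_cong eq)
    moreover have "\<dots> = ennreal r * emeasure lborel {0<..K} - ennreal r * emeasure lborel (B \<inter> {0<..K})"
      using compl lfin
      by (subst nn_integral_diff)
        (auto simp: Ioc_m Ioc_i ennreal_mult_eq_top_iff intro!: AE_I2 emeasure_mono)
    moreover have "\<dots> = ennreal r * emeasure lborel (- B \<inter> {0<..K})"
      unfolding B' using lfin
      by (subst emeasure_Diff) (auto simp: ennreal_right_diff_distrib)
    ultimately show ?case by simp
  next
    case (union B)
    note [measurable] = union(2)
    have disj: "disjoint_family (\<lambda>i. B i \<inter> {0<..K})"
      using union(1) by (auto simp: disjoint_family_on_def)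
    have eq: "?\<kappa> (\<Union>i. B i) \<omega> = (\<Sum>i. ?\<kappa> (B i) \<omega>)" for \<omega>
      using disj by (subst suminf_emeasure) auto
    have leq: "emeasure lborel ((\<Union>i. B i) \<inter> {0<..K}) = (\<Sum>i. emeasure lborel (B i \<inter> {0<..K}))"
      using disj by (subst suminf_emeasure) auto
    show ?case unfolding eq leq using union(3)
      by (simp add: nn_integral_suminf borel_measurable_suminf_order)
  qed
  then show ?thesis1 ?thesis2 by auto
qed

text \<open>The count is a natural number, so if it is nonzero it is at least 1, and Markov's
  inequality bounds the probability of this by the mean count.\<close>

lemma
  assumes N: "poisson_process M r N" and B: "B \<in> sets borel"
  shows measurable_measure_jump_measure:
      "(\<lambda>\<omega>. measure (jump_measure (\<lambda>t. N t \<omega>)) (B \<inter> {0<..K})) \<in> borel_measurable M"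
    and prob_jump_le: "measure M {\<omega>\<in>space M. measure (jump_measure (\<lambda>t. N t \<omega>)) (B \<inter> {0<..K}) \<noteq> 0}
      \<le> r * measure lborel (B \<inter> {0<..K})"
proof -
  let ?\<kappa> = "\<lambda>\<omega>. emeasure (jump_measure (\<lambda>t. N t \<omega>)) (B \<inter> {0<..K})"
  interpret prob_space M using N by (simp add: poisson_process_def)
  have r: "0 < r" using N by (auto simp: poisson_process_def)
  have [measurable]: "?\<kappa> \<in> borel_measurable M"
    using measurable_emeasure_jump_measure[OF N B] .
  show "(\<lambda>\<omega>. measure (jump_measure (\<lambda>t. N t \<omega>)) (B \<inter> {0<..K})) \<in> borel_measurable M"
    unfolding measure_def by measurable
  note lfin = emeasure_lborel_Int_Ioc_finite[of B K]
  have "1 \<le> ?\<kappa> \<omega>"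
    if "\<omega> \<in> space M" "measure (jump_measure (\<lambda>t. N t \<omega>)) (B \<inter> {0<..K}) \<noteq> 0" for \<omega>
  proof -
    note path = poisson_process_counting_path[OF N that(1)]
    obtain n where n: "measure (jump_measure (\<lambda>t. N t \<omega>)) (B \<inter> {0<..K}) = real n"
      using measure_jump_measure_Nats[OF path B] by (auto elim: Nats_cases)
    with that(2) have "1 \<le> measure (jump_measure (\<lambda>t. N t \<omega>)) (B \<inter> {0<..K})"
      by (cases n) auto
    then show ?thesis
      using emeasure_jump_measure_finite[OF path, of B K]
      by (subst emeasure_eq_ennreal_measure) (auto simp: ennreal_leI)
  qed
  then have "emeasure M {\<omega>\<in>space M. measure (jump_measure (\<lambda>t. N t \<omega>)) (B \<inter> {0<..K}) \<noteq> 0}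
      \<le> emeasure M {\<omega>\<in>space M. 1 \<le> 1 * ?\<kappa> \<omega>}"
    by (intro emeasure_mono) auto
  also have "\<dots> \<le> 1 * (\<integral>\<^sup>+\<omega>. ?\<kappa> \<omega> * indicator (space M) \<omega> \<partial>M)"
    by (rule nn_integral_Markov_inequality) auto
  also have "\<dots> = (\<integral>\<^sup>+\<omega>. ?\<kappa> \<omega> \<partial>M)"
    by (simp cong: nn_integral_cong)
  also have "\<dots> = ennreal r * emeasure lborel (B \<inter> {0<..K})"
    by (rule nn_integral_emeasure_jump_measure[OF N B])
  also have "\<dots> = ennreal (r * measure lborel (B \<inter> {0<..K}))"
    using r lfin by (simp add: ennreal_mult' emeasure_eq_ennreal_measure)
  finally show "measure M {\<omega>\<in>space M. measure (jump_measure (\<lambda>t. N t \<omega>)) (B \<inter> {0<..K}) \<noteq> 0}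
      \<le> r * measure lborel (B \<inter> {0<..K})"
    using r by (simp add: emeasure_eq_measure)
qed

subsection \<open>Dyadic approximation of Borel sets\<close>

text \<open>These are the unions of cells of mesh \<open>1 / 2 ^ j\<close>. Equality of ceilings
  makes the cells open on the left and closed on the right, like the intervals whose mass is an
  increment of the path.\<close>

definition dyadic_set :: "nat \<Rightarrow> real set \<Rightarrow> bool" where
  "dyadic_set j E \<longleftrightarrow> (\<forall>x y. \<lceil>x * 2 ^ j\<rceil> = \<lceil>y * 2 ^ j\<rceil> \<longrightarrow> (x \<in> E \<longleftrightarrow> y \<in> E))"

lemma dyadic_set_measurable [measurable]:
  assumes "dyadic_set j E"
  shows "E \<in> sets borel"
proof -
  have "E = (\<lambda>x. \<lceil>x * 2 ^ j\<rceil>) -` (\<lambda>x. \<lceil>x * 2 ^ j\<rceil>) ` E \<inter> space borel"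
    using assms unfolding dyadic_set_def space_borel by blast
  also have "\<dots> \<in> sets borel"
    by (rule measurable_sets[of _ borel "count_space UNIV"]) auto
  finally show ?thesis .
qed

text \<open>Finer cells lie inside coarser ones: an integer upper bound at level \<open>j\<close>,
  multiplied by \<open>2 ^ (k - j)\<close>, is an integer upper bound at level \<open>k\<close>, and
  such bounds hold for a number exactly if they hold for its ceiling.\<close>

lemma ceiling_mult_power2_eq:
  fixes x y :: real
  assumes "j \<le> k" and "\<lceil>x * 2 ^ k\<rceil> = \<lceil>y * 2 ^ k\<rceil>"
  shows "\<lceil>x * 2 ^ j\<rceil> = \<lceil>y * 2 ^ j\<rceil>"
proof -
  have *: "\<lceil>x * 2 ^ j\<rceil> \<le> \<lceil>y * 2 ^ j\<rceil>" if "\<lceil>x * 2 ^ k\<rceil> = \<lceil>y * 2 ^ k\<rceil>" for x y :: real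
  proof -
    have k: "(2::real) ^ k = 2 ^ j * 2 ^ (k - j)"
      using assms(1) by (simp flip: power_add)
    have "y * 2 ^ j \<le> of_int \<lceil>y * 2 ^ j\<rceil>" by simp
    then have "y * 2 ^ k \<le> of_int (\<lceil>y * 2 ^ j\<rceil> * 2 ^ (k - j))"
      unfolding k by (simp add: mult.assoc[symmetric])
    then have "\<lceil>x * 2 ^ k\<rceil> \<le> \<lceil>y * 2 ^ j\<rceil> * 2 ^ (k - j)"
      using that by (simp only: ceiling_le_iff)
    then have "x * 2 ^ k \<le> of_int (\<lceil>y * 2 ^ j\<rceil> * 2 ^ (k - j))"
      by (simp only: ceiling_le_iff)
    then have "x * 2 ^ j \<le> of_int \<lceil>y * 2 ^ j\<rceil>"
      unfolding k by (simp add: mult.assoc[symmetric])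
    then show ?thesis by (simp only: ceiling_le_iff)
  qed
  show ?thesis using *[of x y] *[of y x] assms(2) by simp
qed

lemma dyadic_set_mono:
  assumes "dyadic_set j E" "j \<le> k"
  shows "dyadic_set k E"
  unfolding dyadic_set_def
proof (intro allI impI)
  fix x y :: real assume "\<lceil>x * 2 ^ k\<rceil> = \<lceil>y * 2 ^ k\<rceil>"
  then have "\<lceil>x * 2 ^ j\<rceil> = \<lceil>y * 2 ^ j\<rceil>"
    by (rule ceiling_mult_power2_eq[OF assms(2)])
  then show "x \<in> E \<longleftrightarrow> y \<in> E"
    using assms(1) unfolding dyadic_set_def by blast
qed

lemma dyadic_set_Compl: "dyadic_set j E \<Longrightarrow> dyadic_set j (- E)"
  unfolding dyadic_set_def by blast

lemma dyadic_set_Un: "dyadic_set j E \<Longrightarrow> dyadic_set j F \<Longrightarrow> dyadic_set j (E \<union> F)"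
  unfolding dyadic_set_def by blast

lemma measure_lborel_Int_Ioc_mono:
  assumes "A \<subseteq> B" "A \<in> sets borel" "B \<in> sets borel"
  shows "measure lborel (A \<inter> {0<..K::real}) \<le> measure lborel (B \<inter> {0<..K})"
  using assms emeasure_lborel_Int_Ioc_finite[of B K]
  by (intro measure_mono_fmeasurable) (auto simp: fmeasurable_def)

lemma measure_lborel_Int_Ioc_Un_le:
  assumes "A \<in> sets borel" "B \<in> sets borel"
  shows "measure lborel ((A \<union> B) \<inter> {0<..K::real}) \<le>
    measure lborel (A \<inter> {0<..K}) + measure lborel (B \<inter> {0<..K})"
proof -
  have "(A \<union> B) \<inter> {0<..K} = A \<inter> {0<..K} \<union> B \<inter> {0<..K}" by auto
  then show ?thesis
    using assms by (simp add: measure_Un_le)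
qed

definition dyadic_approx :: "real \<Rightarrow> real set \<Rightarrow> bool" where
  "dyadic_approx K B \<longleftrightarrow> (\<forall>e>0. \<exists>j E. dyadic_set j E \<and> measure lborel (sym_diff B E \<inter> {0<..K}) < e)"

text \<open>The symmetric difference of unions lies in the union of the symmetric differences, so
  the errors add; the two approximants are brought to the finer of their levels.\<close>

lemma dyadic_approx_Un:
  assumes B: "B \<in> sets borel" "dyadic_approx K B" and C: "C \<in> sets borel" "dyadic_approx K C"
  shows "dyadic_approx K (B \<union> C)"
  unfolding dyadic_approx_def
proof (intro allI impI)
  fix e :: real assume "0 < e"
  then have e: "0 < e / 2" by simp
  obtain i E where E: "dyadic_set i E" "measure lborel (sym_diff B E \<inter> {0<..K}) < e / 2"
    using B(2) e unfolding dyadic_approx_def by blast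
  obtain j F where F: "dyadic_set j F" "measure lborel (sym_diff C F \<inter> {0<..K}) < e / 2"
    using C(2) e unfolding dyadic_approx_def by blast
  note [measurable] = B(1) C(1) dyadic_set_measurable[OF E(1)] dyadic_set_measurable[OF F(1)]
  have "measure lborel (sym_diff (B \<union> C) (E \<union> F) \<inter> {0<..K}) \<le>
      measure lborel ((sym_diff B E \<union> sym_diff C F) \<inter> {0<..K})"
    by (intro measure_lborel_Int_Ioc_mono) auto
  also have "\<dots> \<le> measure lborel (sym_diff B E \<inter> {0<..K}) + measure lborel (sym_diff C F \<inter> {0<..K})"
    by (intro measure_lborel_Int_Ioc_Un_le) auto
  also have "\<dots> < e" using E(2) F(2) by simp
  finally have "measure lborel (sym_diff (B \<union> C) (E \<union> F) \<inter> {0<..K}) < e" .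
  moreover have "dyadic_set (max i j) (E \<union> F)"
    using E(1) F(1) by (intro dyadic_set_Un) (auto elim: dyadic_set_mono)
  ultimately show "\<exists>j E. dyadic_set j E \<and> measure lborel (sym_diff (B \<union> C) E \<inter> {0<..K}) < e"
    by blast
qed

lemma dyadic_approx_borel:
  assumes "B \<in> sets borel"
  shows "dyadic_approx K B"
  using assms
proof (induction rule: borel_real_induct)
  case (atMost a)
  show ?case unfolding dyadic_approx_def
  proof (intro allI impI)
    fix e :: real assume "0 < e"
    then obtain j where j: "(1/2) ^ j < e"
      using real_arch_pow_inv[of e "1/2"] by auto
    \<comment> \<open>\<open>E\<close> is the ray with \<open>a\<close> rounded up to the grid, so
      the error fits into an interval of one mesh length.\<close>
    define E where "E = {x::real. \<lceil>x * 2 ^ j\<rceil> \<le> \<lceil>a * 2 ^ j\<rceil>}"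
    have E: "dyadic_set j E" by (simp add: dyadic_set_def E_def)
    have "x \<in> {a..a + (1/2) ^ j}" if "x \<in> sym_diff {..a} E" for x
    proof -
      have "\<lceil>x * 2 ^ j\<rceil> \<le> \<lceil>a * 2 ^ j\<rceil>" if "x \<le> a"
        using that by (intro ceiling_mono mult_right_mono) auto
      with that have "a < x" and "\<lceil>x * 2 ^ j\<rceil> \<le> \<lceil>a * 2 ^ j\<rceil>"
        by (auto simp: E_def not_le)
      then have "x * 2 ^ j \<le> a * 2 ^ j + 1" by linarith
      with \<open>a < x\<close> show ?thesis by (simp add: field_simps power_divide)
    qed
    then have "sym_diff {..a} E \<inter> {0<..K} \<subseteq> {a..a + (1/2) ^ j}" by blast
    then have "measure lborel (sym_diff {..a} E \<inter> {0<..K}) \<le> measure lborel {a..a + (1/2) ^ j}"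
      using dyadic_set_measurable[OF E]
      by (intro measure_mono_fmeasurable) (simp_all add: fmeasurable_def)
    also have "\<dots> < e" using j by simp
    finally show "\<exists>j E. dyadic_set j E \<and> measure lborel (sym_diff {..a} E \<inter> {0<..K}) < e"
      using E by blast
  qed
next
  case empty
  have "dyadic_set 0 {}" by (simp add: dyadic_set_def)
  then show ?case by (force simp: dyadic_approx_def)
next
  case (compl B)
  have "sym_diff (- B) (- E) = sym_diff B E" for E by auto
  with compl(2) dyadic_set_Compl show ?case
    unfolding dyadic_approx_def by metis
next
  case (union B)
  note [measurable] = union(2)
  have fin: "dyadic_approx K (\<Union>i<n. B i)" for n
  proof (induction n)
    case 0
    have "dyadic_set 0 {}" by (simp add: dyadic_set_def)
    then show ?case by (force simp: dyadic_approx_def)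
  next
    case (Suc n)
    then show ?case
      using union(3)[of n] by (auto simp: lessThan_Suc intro!: dyadic_approx_Un)
  qed
  show ?case unfolding dyadic_approx_def
  proof (intro allI impI)
    fix e :: real assume e: "0 < e"
    \<comment> \<open>What remains of the union after \<open>n\<close> sets decreases to the empty
      set inside a window of finite measure, so its measure tends to 0 and a finite union
      suffices.\<close>
    let ?R = "\<lambda>n. ((\<Union>i. B i) - (\<Union>i<n. B i)) \<inter> {0<..K}"
    have "(\<lambda>n. measure lborel (?R n)) \<longlonglongrightarrow> measure lborel (\<Inter>n. ?R n)"
      using emeasure_lborel_Int_Ioc_finite[of "(\<Union>i. B i) - (\<Union>i<n. B i)" K for n]
      by (intro Lim_measure_decseq) (auto simp: decseq_def less_top intro: less_le_trans)
    moreover have "(\<Inter>n. ?R n) = {}" by blast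
    ultimately have "(\<lambda>n. measure lborel (?R n)) \<longlonglongrightarrow> 0" by simp
    then have "\<forall>\<^sub>F n in sequentially. measure lborel (?R n) < e / 2"
      using e by (intro order_tendstoD) auto
    then obtain n where n: "measure lborel (?R n) < e / 2"
      by (auto simp: eventually_sequentially)
    obtain j E where E: "dyadic_set j E" "measure lborel (sym_diff (\<Union>i<n. B i) E \<inter> {0<..K}) < e / 2"
      using fin[of n] e unfolding dyadic_approx_def by (meson half_gt_zero)
    note [measurable] = dyadic_set_measurable[OF E(1)]
    have "measure lborel (sym_diff (\<Union>i. B i) E \<inter> {0<..K}) \<le>
        measure lborel ((((\<Union>i. B i) - (\<Union>i<n. B i)) \<union> sym_diff (\<Union>i<n. B i) E) \<inter> {0<..K})"
      by (intro measure_lborel_Int_Ioc_mono) auto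
    also have "\<dots> \<le> measure lborel (?R n) + measure lborel (sym_diff (\<Union>i<n. B i) E \<inter> {0<..K})"
      by (intro measure_lborel_Int_Ioc_Un_le) auto
    also have "\<dots> < e" using n E(2) by simp
    finally show "\<exists>j E. dyadic_set j E \<and> measure lborel (sym_diff (\<Union>i. B i) E \<inter> {0<..K}) < e"
      using E(1) by blast
  qed
qed

subsection \<open>Thinning on a grid\<close>

text \<open>A cell belongs to \<open>E\<close> as a whole or not at all, so its right end point
  decides.\<close>

lemma dyadic_set_cell:
  assumes E: "dyadic_set j E" and x: "real i / 2 ^ j < x" "x \<le> real (Suc i) / 2 ^ j"
  shows "x \<in> E \<longleftrightarrow> real (Suc i) / 2 ^ j \<in> E"
proof -
  have "\<lceil>x * 2 ^ j\<rceil> = int (Suc i)"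
    using x by (intro ceiling_unique) (auto simp: field_simps)
  moreover have "\<lceil>real (Suc i) / 2 ^ j * 2 ^ j\<rceil> = int (Suc i)"
    by (intro ceiling_unique) auto
  ultimately show ?thesis using E unfolding dyadic_set_def by metis
qed

text \<open>Stated for a general measure because it is applied twice: to \<open>jump_measure\<close>
  it gives the thinned process, to \<open>lborel\<close> the clock.\<close>

lemma measure_dyadic_set:
  assumes E: "dyadic_set j E" and [measurable_cong]: "sets \<mu> = sets borel"
    and fin: "\<And>K. emeasure \<mu> {0<..K} < \<infinity>"
  shows "measure \<mu> (E \<inter> {0<..real l / 2 ^ j}) =
    (\<Sum>i<l. if real (Suc i) / 2 ^ j \<in> E then measure \<mu> {real i / 2 ^ j<..real (Suc i) / 2 ^ j} else 0)"
proof (induction l)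
  case 0
  then show ?case by simp
next
  case (Suc l)
  let ?a = "real l / 2 ^ j" and ?b = "real (Suc l) / 2 ^ j"
  have ab: "0 \<le> ?a" "?a \<le> ?b" by (auto simp: divide_right_mono)
  have [measurable]: "E \<in> sets borel" using E by (rule dyadic_set_measurable)
  have fin': "emeasure \<mu> (F \<inter> {0<..K}) \<noteq> \<infinity>" for F K
  proof -
    have "emeasure \<mu> (F \<inter> {0<..K}) \<le> emeasure \<mu> {0<..K}"
      by (intro emeasure_mono) auto
    also note fin
    finally show ?thesis by simp
  qed
  have eq: "E \<inter> {0<..?b} = E \<inter> {0<..?a} \<union> (if ?b \<in> E then {?a<..?b} else {})"
  proof (rule set_eqI)
    fix x show "x \<in> E \<inter> {0<..?b} \<longleftrightarrow> x \<in> E \<inter> {0<..?a} \<union> (if ?b \<in> E then {?a<..?b} else {})"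
    proof (cases "?a < x")
      case True
      moreover have "x \<in> E \<longleftrightarrow> ?b \<in> E" if "x \<le> ?b"
        using dyadic_set_cell[OF E True that] .
      moreover have "0 < x" using True ab(1) by linarith
      ultimately show ?thesis by (cases "?b \<in> E") (auto simp del: of_nat_Suc)
    next
      case False
      then have "x \<le> ?b" using ab(2) by linarith
      with False show ?thesis by (simp del: of_nat_Suc)
    qed
  qed
  have "{?a<..?b} \<inter> {0<..?b} = {?a<..?b}" using ab by auto
  then have "emeasure \<mu> {?a<..?b} \<noteq> \<infinity>"
    using fin'[of "{?a<..?b}" ?b] by simp
  then have "measure \<mu> (E \<inter> {0<..?b}) =
      measure \<mu> (E \<inter> {0<..?a}) + measure \<mu> (if ?b \<in> E then {?a<..?b} else {})"
    unfolding eq using fin'[of E ?a] by (intro measure_Union) auto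
  with Suc show ?case by (simp split: if_splits)
qed

lemma measurable_sum_nat [measurable (raw)]:
  fixes f :: "'i \<Rightarrow> 'a \<Rightarrow> nat"
  assumes "\<And>i. i \<in> I \<Longrightarrow> f i \<in> measurable M (count_space UNIV)"
  shows "(\<lambda>x. \<Sum>i\<in>I. f i x) \<in> measurable M (count_space UNIV)"
  using assms
proof (induction I rule: infinite_finite_induct)
  case (insert i I)
  then have [measurable]: "f i \<in> measurable M (count_space UNIV)"
    "(\<lambda>x. \<Sum>i\<in>I. f i x) \<in> measurable M (count_space UNIV)" by auto
  show ?case using insert by simp
qed auto

lemma poisson_process_increment_distr:
  assumes "poisson_process M r N" "0 \<le> s" "s < t"
  shows "distr M (count_space UNIV) (\<lambda>\<omega>. N t \<omega> - N s \<omega>) = measure_pmf (poisson_pmf (r * (t - s)))"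
  using assms by (auto simp: poisson_process_def)

text \<open>Both families consist of independent variables, and their marginals agree.\<close>

lemma distr_thinned_increments:
  fixes c :: "nat \<Rightarrow> bool" and h :: real
  assumes N: "poisson_process M r N" and h: "0 < h"
  defines "m \<equiv> \<lambda>l. \<Sum>i<l. if c i then h else 0"
  shows "distr M (PiM {..<n} (\<lambda>_. count_space UNIV))
        (\<lambda>\<omega>. \<lambda>i\<in>{..<n}. if c i then N (real (Suc i) * h) \<omega> - N (real i * h) \<omega> else 0) =
      distr M (PiM {..<n} (\<lambda>_. count_space UNIV)) (\<lambda>\<omega>. \<lambda>i\<in>{..<n}. N (m (Suc i)) \<omega> - N (m i) \<omega>)"
\<comment> \<open>The characterisation of independence by a product law needs a nonempty index
  set.\<close>
proof (cases "n = 0")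
  case True
  then show ?thesis by (intro distr_cong) auto
next
  case False
  interpret prob_space M using N by (simp add: poisson_process_def)
  let ?X = "\<lambda>i \<omega>. if c i then N (real (Suc i) * h) \<omega> - N (real i * h) \<omega> else 0"
  let ?Y = "\<lambda>i \<omega>. N (m (Suc i)) \<omega> - N (m i) \<omega>"
  have m: "0 \<le> m i" for i
    unfolding m_def using h by (intro sum_nonneg) auto
  have [measurable]: "N (real i * h) \<in> measurable M (count_space UNIV)"
    "N (m i) \<in> measurable M (count_space UNIV)" for i
    using poisson_process_measurable[OF N] m h by auto
  have ind: "indep_vars (\<lambda>_. count_space UNIV) (\<lambda>i \<omega>. N (t (Suc i)) \<omega> - N (t i) \<omega>) {..<n}"
    if "0 \<le> t 0" "\<And>i. t i \<le> t (Suc i)" for t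
    using N that by (auto simp: poisson_process_def)
  have Y: "indep_vars (\<lambda>_. count_space UNIV) ?Y {..<n}"
    using h by (intro ind) (auto simp: m_def)
  have "indep_vars (\<lambda>_. count_space UNIV)
      (\<lambda>i \<omega>. (\<lambda>k. if c i then k else 0) (N (real (Suc i) * h) \<omega> - N (real i * h) \<omega>)) {..<n}"
    using h by (intro indep_vars_compose2[OF ind[of "\<lambda>i. real i * h"]]) (auto simp: mult_right_mono)
  then have X: "indep_vars (\<lambda>_. count_space UNIV) ?X {..<n}"
    by simp
  have XY: "distr M (count_space UNIV) (?X i) = distr M (count_space UNIV) (?Y i)" for i
  proof (cases "c i")
    case True
    have "m i < m (Suc i)" using True h by (simp add: m_def)
    moreover have "m (Suc i) - m i = real (Suc i) * h - real i * h"
      using True by (simp add: m_def algebra_simps)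
    ultimately show ?thesis
      using True h m[of i] poisson_process_increment_distr[OF N, of "real i * h" "real (Suc i) * h"]
        poisson_process_increment_distr[OF N, of "m i" "m (Suc i)"]
      by simp
  next
    case False
    \<comment> \<open>On a cell that is left out the clock stands still, so both variables are
      constantly 0.\<close>
    then have "m (Suc i) = m i" by (simp add: m_def)
    with False show ?thesis by simp
  qed
  have "distr M (PiM {..<n} (\<lambda>_. count_space UNIV)) (\<lambda>\<omega>. \<lambda>i\<in>{..<n}. ?X i \<omega>) =
      PiM {..<n} (\<lambda>i. distr M (count_space UNIV) (?X i))"
    using False X by (subst indep_vars_iff_distr_eq_PiM'[symmetric]) auto
  also have "\<dots> = PiM {..<n} (\<lambda>i. distr M (count_space UNIV) (?Y i))"
    by (intro PiM_cong refl XY)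
  also have "\<dots> = distr M (PiM {..<n} (\<lambda>_. count_space UNIV)) (\<lambda>\<omega>. \<lambda>i\<in>{..<n}. ?Y i \<omega>)"
    using False Y by (subst (asm) indep_vars_iff_distr_eq_PiM') auto
  finally show ?thesis .
qed

text \<open>Both processes at grid times are partial sums of their increments, so the equality of
  the laws of the increments is pushed forward along the summation map \<open>?S\<close>, which
  sends \<open>n\<close> increments to \<open>n + 1\<close> values.\<close>

lemma distr_thinned_process:
  fixes c :: "nat \<Rightarrow> bool" and h :: real
  assumes N: "poisson_process M r N" and h: "0 < h"
  defines "m \<equiv> \<lambda>l. \<Sum>i<l. if c i then h else 0"
  shows "distr M (PiM {..n} (\<lambda>_. count_space UNIV))
        (\<lambda>\<omega>. \<lambda>l\<in>{..n}. \<Sum>i<l. if c i then N (real (Suc i) * h) \<omega> - N (real i * h) \<omega> else 0) =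
      distr M (PiM {..n} (\<lambda>_. count_space UNIV)) (\<lambda>\<omega>. \<lambda>l\<in>{..n}. N (m l) \<omega>)"
proof -
  let ?X = "\<lambda>i \<omega>. if c i then N (real (Suc i) * h) \<omega> - N (real i * h) \<omega> else 0"
  let ?Y = "\<lambda>i \<omega>. N (m (Suc i)) \<omega> - N (m i) \<omega>"
  let ?P = "PiM {..<n} (\<lambda>_. count_space (UNIV :: nat set))"
  let ?Q = "PiM {..n} (\<lambda>_. count_space (UNIV :: nat set))"
  let ?S = "\<lambda>x. \<lambda>l\<in>{..n}. \<Sum>i<l. x i :: nat"
  have m: "0 \<le> m i" for i
    unfolding m_def using h by (intro sum_nonneg) auto
  have [measurable]: "N (real i * h) \<in> measurable M (count_space UNIV)"
    "N (m i) \<in> measurable M (count_space UNIV)" for i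
    using poisson_process_measurable[OF N] m h by auto
  have S: "?S \<in> measurable ?P ?Q"
    by (intro measurable_restrict measurable_sum_nat measurable_component_singleton) auto
  have push: "distr M ?Q (\<lambda>\<omega>. \<lambda>l\<in>{..n}. \<Sum>i<l. Z i \<omega>) = distr (distr M ?P (\<lambda>\<omega>. \<lambda>i\<in>{..<n}. Z i \<omega>)) ?Q ?S"
    if "\<And>i. Z i \<in> measurable M (count_space UNIV)" for Z
    using that by (subst distr_distr[OF S])
      (auto simp: fun_eq_iff intro!: distr_cong measurable_restrict sum.cong)
  have "N (m l) \<omega> = (\<Sum>i<l. ?Y i \<omega>)" if "\<omega> \<in> space M" for l \<omega>
  proof (induction l)
    case 0
    then show ?case using N that by (simp add: m_def poisson_process_def)
  next
    case (Suc l)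
    \<comment> \<open>Monotonicity makes the truncated subtraction of naturals exact, so that the
      sum telescopes.\<close>
    have "N (m l) \<omega> \<le> N (m (Suc l)) \<omega>"
      using poisson_process_counting_path[OF N that] m[of l] m[of "Suc l"] h
      by (auto simp: counting_path_def m_def intro!: mono_onD[of "{0..}" "\<lambda>t. N t \<omega>"])
    with Suc show ?case by simp
  qed
  then have "distr M ?Q (\<lambda>\<omega>. \<lambda>l\<in>{..n}. N (m l) \<omega>) = distr M ?Q (\<lambda>\<omega>. \<lambda>l\<in>{..n}. \<Sum>i<l. ?Y i \<omega>)"
    by (intro distr_cong refl restrict_ext)
  also have "\<dots> = distr (distr M ?P (\<lambda>\<omega>. \<lambda>i\<in>{..<n}. ?Y i \<omega>)) ?Q ?S"
    by (rule push) measurable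
  also have "\<dots> = distr (distr M ?P (\<lambda>\<omega>. \<lambda>i\<in>{..<n}. ?X i \<omega>)) ?Q ?S"
    unfolding m_def by (subst distr_thinned_increments[OF N h]) (rule refl)
  also have "\<dots> = distr M ?Q (\<lambda>\<omega>. \<lambda>l\<in>{..n}. \<Sum>i<l. ?X i \<omega>)"
    by (rule push[symmetric]) measurable
  finally show ?thesis ..
qed

text \<open>By independence the joint law is the product of the marginals, so the second marginal
  may be replaced by an equal one. \<open>L\<close> selects the times at which the event is tested;
  in the application they form a coarser grid than the one used for thinning.\<close>

lemma prob_thinned_eq:
  fixes c :: "nat \<Rightarrow> bool" and h :: real and b :: "nat \<Rightarrow> real"
  assumes N: "poisson_process M r N" and N': "poisson_process M r' N'"
    and indep: "independent_processes M N N'" and h: "0 < h" and L: "L \<subseteq> {..n}"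
  defines "m \<equiv> \<lambda>l. \<Sum>i<l. if c i then h else 0"
  shows "measure M {\<omega>\<in>space M. \<forall>l\<in>L. b l < real (N (real l * h) \<omega>) +
        real (\<Sum>i<l. if c i then N' (real (Suc i) * h) \<omega> - N' (real i * h) \<omega> else 0)} =
      measure M {\<omega>\<in>space M. \<forall>l\<in>L. b l < real (N (real l * h) \<omega>) + real (N' (m l) \<omega>)}"
proof -
  interpret prob_space M using N by (simp add: poisson_process_def)
  let ?P = "PiM {0::real..} (\<lambda>_. count_space (UNIV :: nat set))"
  let ?Q = "PiM {..n} (\<lambda>_. count_space (UNIV :: nat set))"
  let ?X = "\<lambda>\<omega>. \<lambda>l\<in>{..n}. N (real l * h) \<omega>"
  let ?U = "\<lambda>\<omega>. \<lambda>l\<in>{..n}. \<Sum>i<l. if c i then N' (real (Suc i) * h) \<omega> - N' (real i * h) \<omega> else 0"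
  let ?V = "\<lambda>\<omega>. \<lambda>l\<in>{..n}. N' (m l) \<omega>"
  let ?E = "{p \<in> space (?Q \<Otimes>\<^sub>M ?Q). \<forall>l\<in>L. b l < real (fst p l) + real (snd p l)}"
  have m: "0 \<le> m i" for i
    unfolding m_def using h by (intro sum_nonneg) auto
  note indep' = indep[unfolded independent_processes_def]
  have proj: "(\<lambda>p. p t) \<in> measurable ?P (count_space UNIV)" if "0 \<le> t" for t
    using that by (intro measurable_component_singleton) auto
  have h0: "0 \<le> real l * h" for l using h by simp
  have at_grid: "(\<lambda>t\<in>{0..}. f t) (real l * h) = f (real l * h)" for f :: "real \<Rightarrow> nat" and l
    using h0[of l] by (simp del: of_nat_Suc)
  have thin: "(\<lambda>p. if c i then p (real (Suc i) * h) - p (real i * h) else 0)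
      \<in> measurable ?P (count_space UNIV)" for i
  proof -
    have "(\<lambda>p. f p - g p) \<in> measurable ?P (count_space UNIV)"
      if [measurable]: "f \<in> measurable ?P (count_space UNIV)" "g \<in> measurable ?P (count_space UNIV)"
      for f g :: "(real \<Rightarrow> nat) \<Rightarrow> nat" by measurable
    from this[OF proj[OF h0[of "Suc i"]] proj[OF h0[of i]]] show ?thesis
      by (cases "c i") simp_all
  qed
  \<comment> \<open>Independence of the whole paths passes to measurable functionals of each of
    them.\<close>
  have "indep_var ?Q ((\<lambda>p. \<lambda>l\<in>{..n}. p (real l * h)) \<circ> (\<lambda>\<omega>. \<lambda>t\<in>{0..}. N t \<omega>))
      ?Q ((\<lambda>p. \<lambda>l\<in>{..n}. \<Sum>i<l. if c i then p (real (Suc i) * h) - p (real i * h) else 0) \<circ>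
        (\<lambda>\<omega>. \<lambda>t\<in>{0..}. N' t \<omega>))"
    by (rule indep_var_compose[OF indep']; intro measurable_restrict measurable_sum_nat thin proj h0)
  then have U: "indep_var ?Q ?X ?Q ?U"
    unfolding comp_def at_grid .
  have "indep_var ?Q ((\<lambda>p. \<lambda>l\<in>{..n}. p (real l * h)) \<circ> (\<lambda>\<omega>. \<lambda>t\<in>{0..}. N t \<omega>))
      ?Q ((\<lambda>p. \<lambda>l\<in>{..n}. p (m l)) \<circ> (\<lambda>\<omega>. \<lambda>t\<in>{0..}. N' t \<omega>))"
    by (rule indep_var_compose[OF indep']; intro measurable_restrict proj h0 m)
  then have V: "indep_var ?Q ?X ?Q ?V"
    using h m by (simp add: comp_def cong: restrict_cong)
  have UV: "distr M ?Q ?U = distr M ?Q ?V"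
    unfolding m_def by (rule distr_thinned_process[OF N' h])
  have joint: "distr M (?Q \<Otimes>\<^sub>M ?Q) (\<lambda>\<omega>. (?X \<omega>, ?U \<omega>)) = distr M (?Q \<Otimes>\<^sub>M ?Q) (\<lambda>\<omega>. (?X \<omega>, ?V \<omega>))"
    using U V UV by (simp add: indep_var_distribution_eq)
  have [measurable]: "(\<lambda>x. x l) \<in> measurable ?Q (count_space UNIV)" if "l \<in> L" for l
    using that L by (intro measurable_component_singleton) auto
  have "finite L" using L by (rule finite_subset) simp
  then have E: "?E \<in> sets (?Q \<Otimes>\<^sub>M ?Q)"
    by measurable
  have ev: "measure M {\<omega>\<in>space M. \<forall>l\<in>L. b l < real (N (real l * h) \<omega>) + real (W l \<omega>)} =
      measure (distr M (?Q \<Otimes>\<^sub>M ?Q) (\<lambda>\<omega>. (?X \<omega>, \<lambda>l\<in>{..n}. W l \<omega>))) ?E"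
    if "indep_var ?Q ?X ?Q (\<lambda>\<omega>. \<lambda>l\<in>{..n}. W l \<omega>)" for W
  proof -
    have XW: "(\<lambda>\<omega>. (?X \<omega>, \<lambda>l\<in>{..n}. W l \<omega>)) \<in> measurable M (?Q \<Otimes>\<^sub>M ?Q)"
      using that by (intro measurable_Pair) (auto dest: indep_var_rv1 indep_var_rv2)
    show ?thesis
      unfolding measure_distr[OF XW E] using L measurable_space[OF XW]
      by (intro arg_cong[where f = "measure M"]) (auto simp: subset_eq)
  qed
  show ?thesis unfolding ev[OF U] ev[OF V] joint ..
qed

subsection \<open>Interruption of off-line policies\<close>

text \<open>Used for the jump measure, to compare counts, and for Lebesgue measure, to compare
  clocks.\<close>

lemma measure_Int_Ioc_le_sym_diff:
  assumes [measurable_cong]: "sets \<mu> = sets borel" and fin: "\<And>K::real. emeasure \<mu> {0<..K} < \<infinity>"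
    and [measurable]: "F \<in> sets borel" "G \<in> sets borel" and t: "t \<le> K"
  shows "measure \<mu> (F \<inter> {0<..t}) \<le> measure \<mu> (G \<inter> {0<..t}) + measure \<mu> (sym_diff F G \<inter> {0<..K})"
proof -
  have fmeas: "B \<inter> {0<..s} \<in> fmeasurable \<mu>" if [measurable]: "B \<in> sets borel" for B s
  proof -
    have "emeasure \<mu> (B \<inter> {0<..s}) \<le> emeasure \<mu> {0<..s}"
      by (intro emeasure_mono) auto
    also note fin
    finally show ?thesis by (auto simp: fmeasurable_def)
  qed
  have "measure \<mu> (F \<inter> {0<..t}) \<le> measure \<mu> (G \<inter> {0<..t} \<union> sym_diff F G \<inter> {0<..K})"
    using t by (intro measure_mono_fmeasurable fmeasurable.Un fmeas) auto
  also have "\<dots> \<le> measure \<mu> (G \<inter> {0<..t}) + measure \<mu> (sym_diff F G \<inter> {0<..K})"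
    by (intro measure_Un_le) auto
  finally show ?thesis .
qed

text \<open>Here \<open>\<tau>\<close> is any clock that dominates the active time in
  \<open>A\<close>. \<open>A\<close> is replaced by a dyadic \<open>E\<close>, for which thinning is
  a change of clock in law; the clock of \<open>E\<close> exceeds \<open>\<tau>\<close> by at most
  \<open>\<delta>\<close> at each grid time, and a jump in so short an interval is
  improbable.\<close>

lemma prob_grid_le:
  fixes b :: "nat \<Rightarrow> real"
  assumes N: "poisson_process M r N" and N': "poisson_process M r' N'"
    and indep: "independent_processes M N N'" and A: "A \<in> sets borel"
    and \<tau>: "\<And>t. 0 \<le> t \<Longrightarrow> measure lborel (A \<inter> {0<..t}) \<le> \<tau> t"
  shows "measure M {\<omega>\<in>space M. \<forall>l\<le>n. b l < real (N (real l / 2 ^ k) \<omega>) +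
        measure (jump_measure (\<lambda>t. N' t \<omega>)) (A \<inter> {0<..real l / 2 ^ k})} \<le>
      measure M {\<omega>\<in>space M. \<forall>l\<le>n. b l < real (N (real l / 2 ^ k) \<omega>) +
        real (N' (\<tau> (real l / 2 ^ k)) \<omega>)}"
    (is "measure M ?GA \<le> measure M ?G\<tau>")
proof (rule field_le_epsilon)
  fix e :: real assume e: "0 < e"
  interpret prob_space M using N by (simp add: poisson_process_def)
  have r': "0 < r'" using N' by (simp add: poisson_process_def)
  note path = poisson_process_counting_path[OF N']
  let ?\<kappa> = "\<lambda>\<omega>. jump_measure (\<lambda>t. N' t \<omega>)"
  define K where "K = real n / 2 ^ k"
  \<comment> \<open>There will be \<open>n + 2\<close> exceptional events of probability at most
    \<open>r' * \<delta>\<close> each: one for passing from \<open>A\<close> to \<open>E\<close> and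
    one for each of the \<open>n + 1\<close> grid times. Together they cost
    \<open>e\<close>.\<close>
  define \<delta> where "\<delta> = e / (r' * (real n + 2))"
  have \<delta>: "0 < \<delta>" using e r' by (simp add: \<delta>_def)
  obtain j0 E where E0: "dyadic_set j0 E" and E_approx: "measure lborel (sym_diff A E \<inter> {0<..K}) < \<delta>"
    using dyadic_approx_borel[OF A, of K] \<delta> unfolding dyadic_approx_def by blast
  \<comment> \<open>Thinning takes place on a grid that refines both that of \<open>E\<close> and
    that of the observation times.\<close>
  define j where "j = max j0 k"
  have E: "dyadic_set j E" using E0 by (auto simp: j_def intro: dyadic_set_mono)
  note [measurable] = A dyadic_set_measurable[OF E]
  define h :: real where "h = 1 / 2 ^ j"
  \<comment> \<open>The number of fine cells in an observation cell: observation time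
    \<open>l\<close> has index \<open>l * q\<close> on the fine grid.\<close>
  define q :: nat where "q = 2 ^ (j - k)"
  define c where "c = (\<lambda>i. real (Suc i) / 2 ^ j \<in> E)"
  define m where "m = (\<lambda>l. \<Sum>i<l. if c i then h else 0)"
  have h: "0 < h" by (simp add: h_def)
  have times_h: "real l * h = real l / 2 ^ j" for l by (simp add: h_def)
  have q: "0 < q" by (simp add: q_def)
  have "2 ^ j = real q * 2 ^ k"
    by (simp add: q_def j_def flip: power_add)
  then have grid: "real (l * q) / 2 ^ j = real l / 2 ^ k" for l
    using q by simp
  have grid_le: "real l / 2 ^ k \<le> K" if "l \<le> n" for l
    using that by (simp add: K_def divide_right_mono)
  define L where "L = (\<lambda>l. l * q) ` {..n}"
  have all_L: "(\<forall>l\<in>L. P l) \<longleftrightarrow> (\<forall>l\<le>n. P (l * q))" for P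
    by (auto simp: L_def)
  define b' where "b' = (\<lambda>l. b (l div q))"
  have L: "L \<subseteq> {..n * q}" by (auto simp: L_def)
  have b': "b' (l * q) = b l" for l using q by (simp add: b'_def)
  let ?U = "\<lambda>\<omega> l. \<Sum>i<l. if c i then N' (real (Suc i) * h) \<omega> - N' (real i * h) \<omega> else 0"
  let ?GE = "{\<omega>\<in>space M. \<forall>l\<le>n. b l < real (N (real l / 2 ^ k) \<omega>) +
    measure (?\<kappa> \<omega>) (E \<inter> {0<..real l / 2 ^ k})}"
  let ?GV = "{\<omega>\<in>space M. \<forall>l\<le>n. b l < real (N (real l / 2 ^ k) \<omega>) + real (N' (m (l * q)) \<omega>)}"
  \<comment> \<open>The jumps in \<open>E\<close> are counted cell by cell, which is the grid
    thinning treated before.\<close>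
  have U: "measure (?\<kappa> \<omega>) (E \<inter> {0<..real l / 2 ^ j}) = real (?U \<omega> l)" if "\<omega> \<in> space M" for \<omega> l
    unfolding measure_dyadic_set[OF E sets_jump_measure emeasure_jump_measure_Ioc_finite[OF path[OF that]]]
      of_nat_sum c_def times_h
  proof (intro sum.cong refl)
    fix i
    have ab: "0 \<le> real i / 2 ^ j" "real i / 2 ^ j \<le> real (Suc i) / 2 ^ j"
      by (auto simp: divide_right_mono)
    then have "N' (real i / 2 ^ j) \<omega> \<le> N' (real (Suc i) / 2 ^ j) \<omega>"
      using path[OF that] unfolding counting_path_def
      by (auto intro!: mono_onD[of "{0..}" "\<lambda>t. N' t \<omega>"] simp del: of_nat_Suc)
    then show "(if real (Suc i) / 2 ^ j \<in> E
        then measure (?\<kappa> \<omega>) {real i / 2 ^ j<..real (Suc i) / 2 ^ j} else 0) =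
      real (if real (Suc i) / 2 ^ j \<in> E
        then N' (real (Suc i) / 2 ^ j) \<omega> - N' (real i / 2 ^ j) \<omega> else 0)"
      using ab by (simp add: measure_jump_measure_Ioc[OF path[OF that]] of_nat_diff del: of_nat_Suc)
  qed
  have "measure M ?GE = measure M {\<omega>\<in>space M. \<forall>l\<in>L. b' l < real (N (real l * h) \<omega>) + real (?U \<omega> l)}"
    by (intro arg_cong[where f = "measure M"] Collect_cong conj_cong refl)
      (simp add: all_L b' U[symmetric] times_h grid del: of_nat_sum of_nat_mult)
  also have "\<dots> = measure M {\<omega>\<in>space M. \<forall>l\<in>L. b' l < real (N (real l * h) \<omega>) + real (N' (m l) \<omega>)}"
    unfolding m_def by (rule prob_thinned_eq[OF N N' indep h L])
  also have "\<dots> = measure M ?GV"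
    by (simp add: all_L b' times_h grid del: of_nat_mult)
  finally have GE_GV: "measure M ?GE = measure M ?GV" .

  have [measurable]: "N (real l / 2 ^ k) \<in> measurable M (count_space UNIV)" for l
    by (rule poisson_process_measurable[OF N]) simp
  have \<tau>_nonneg: "0 \<le> \<tau> t" if "0 \<le> t" for t
    using \<tau>[OF that] measure_nonneg order_trans by blast
  have [measurable]: "N' (\<tau> (real l / 2 ^ k)) \<in> measurable M (count_space UNIV)" for l
    by (rule poisson_process_measurable[OF N']) (simp add: \<tau>_nonneg)
  have [measurable]: "(\<lambda>\<omega>. measure (?\<kappa> \<omega>) (B \<inter> {0<..s})) \<in> borel_measurable M"
    if "B \<in> sets borel" for B s
    by (rule measurable_measure_jump_measure[OF N' that])

  \<comment> \<open>Unless there is a jump where \<open>A\<close> and \<open>E\<close> differ, the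
    count in \<open>A\<close> is at most the count in \<open>E\<close> at every grid time.\<close>
  let ?Bad = "{\<omega>\<in>space M. measure (?\<kappa> \<omega>) (sym_diff A E \<inter> {0<..K}) \<noteq> 0}"
  have "?GA \<subseteq> ?GE \<union> ?Bad"
  proof
    fix \<omega> assume \<omega>: "\<omega> \<in> ?GA"
    show "\<omega> \<in> ?GE \<union> ?Bad"
    proof (cases "\<omega> \<in> ?Bad")
      case False
      have "measure (?\<kappa> \<omega>) (A \<inter> {0<..real l / 2 ^ k}) \<le> measure (?\<kappa> \<omega>) (E \<inter> {0<..real l / 2 ^ k})"
        if "l \<le> n" for l
        using measure_Int_Ioc_le_sym_diff[OF sets_jump_measure
            emeasure_jump_measure_Ioc_finite[OF path] _ _ grid_le[OF that], of \<omega> A E] \<omega> False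
        by simp
      with \<omega> show ?thesis by (fastforce intro: less_le_trans)
    qed simp
  qed
  then have "measure M ?GA \<le> measure M (?GE \<union> ?Bad)"
    by (intro finite_measure_mono) auto
  also have "\<dots> \<le> measure M ?GE + measure M ?Bad"
    by (intro measure_Un_le) auto
  also have "measure M ?Bad \<le> r' * measure lborel (sym_diff A E \<inter> {0<..K})"
    by (rule prob_jump_le[OF N']) auto
  also have "\<dots> \<le> r' * \<delta>"
    using E_approx r' by simp
  finally have GA_GE: "measure M ?GA \<le> measure M ?GE + r' * \<delta>" by simp

  \<comment> \<open>The event of a jump within \<open>\<delta>\<close> after \<open>\<tau>\<close>;
    the intersection with \<open>{0<..}\<close> bounded on the right gives it the form required by
    \<open>prob_jump_le\<close>.\<close>
  let ?Bad' = "\<lambda>l. {\<omega>\<in>space M. measure (?\<kappa> \<omega>)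
    ({\<tau> (real l / 2 ^ k)<..} \<inter> {0<..\<tau> (real l / 2 ^ k) + \<delta>}) \<noteq> 0}"
  \<comment> \<open>The clock of the thinned process is the Lebesgue measure of the part of
    \<open>E\<close> used so far.\<close>
  have m_eq: "m (l * q) = measure lborel (E \<inter> {0<..real l / 2 ^ k})" for l
    unfolding grid[symmetric] m_def c_def
    by (subst measure_dyadic_set[OF E _ emeasure_lborel_Ioc_finite])
      (auto simp: h_def diff_divide_distrib[symmetric] divide_right_mono intro!: sum.cong)
  have "?GV \<subseteq> ?G\<tau> \<union> (\<Union>l\<in>{..n}. ?Bad' l)"
  proof
    fix \<omega> assume \<omega>: "\<omega> \<in> ?GV"
    then have "\<omega> \<in> space M" by simp
    note path = path[OF this]
    show "\<omega> \<in> ?G\<tau> \<union> (\<Union>l\<in>{..n}. ?Bad' l)"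
    proof (cases "\<omega> \<in> (\<Union>l\<in>{..n}. ?Bad' l)")
      case False
      have "N' (m (l * q)) \<omega> \<le> N' (\<tau> (real l / 2 ^ k)) \<omega>" if l: "l \<le> n" for l
      proof -
        let ?\<tau> = "\<tau> (real l / 2 ^ k)"
        have \<tau>0: "0 \<le> ?\<tau>" by (simp add: \<tau>_nonneg)
        have "m (l * q) \<le> measure lborel (A \<inter> {0<..real l / 2 ^ k}) +
            measure lborel (sym_diff E A \<inter> {0<..K})"
          unfolding m_eq using grid_le[OF l]
          by (intro measure_Int_Ioc_le_sym_diff emeasure_lborel_Ioc_finite) auto
        also have "sym_diff E A = sym_diff A E" by auto
        finally have "m (l * q) \<le> ?\<tau> + \<delta>"
          using E_approx \<tau>[of "real l / 2 ^ k"] by simp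
        moreover have "0 \<le> m (l * q)" by (simp add: m_eq)
        ultimately have le: "N' (m (l * q)) \<omega> \<le> N' (?\<tau> + \<delta>) \<omega>"
          using path unfolding counting_path_def
          by (auto intro!: mono_onD[of "{0..}" "\<lambda>t. N' t \<omega>"])
        have "{?\<tau><..} \<inter> {0<..?\<tau> + \<delta>} = {?\<tau><..?\<tau> + \<delta>}"
          using \<tau>0 by auto
        moreover have "measure (?\<kappa> \<omega>) ({?\<tau><..} \<inter> {0<..?\<tau> + \<delta>}) = 0"
          using False l \<open>\<omega> \<in> space M\<close> by blast
        ultimately have "measure (?\<kappa> \<omega>) {?\<tau><..?\<tau> + \<delta>} = 0" by simp
        then have "N' (?\<tau> + \<delta>) \<omega> = N' ?\<tau> \<omega>"
          using measure_jump_measure_Ioc[OF path \<tau>0, of "?\<tau> + \<delta>"] \<delta> by simp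
        with le show ?thesis by simp
      qed
      with \<omega> show ?thesis by (fastforce intro: less_le_trans)
    qed simp
  qed
  then have "measure M ?GV \<le> measure M (?G\<tau> \<union> (\<Union>l\<in>{..n}. ?Bad' l))"
    by (intro finite_measure_mono) auto
  also have "\<dots> \<le> measure M ?G\<tau> + measure M (\<Union>l\<in>{..n}. ?Bad' l)"
    by (intro measure_Un_le) auto
  also have "measure M (\<Union>l\<in>{..n}. ?Bad' l) \<le> (\<Sum>l\<in>{..n}. measure M (?Bad' l))"
    by (intro measure_UNION_le) auto
  also have "\<dots> \<le> (\<Sum>l\<in>{..n}. r' * \<delta>)"
  proof (intro sum_mono)
    fix l
    let ?\<tau> = "\<tau> (real l / 2 ^ k)"
    have "{?\<tau><..} \<inter> {0<..?\<tau> + \<delta>} = {?\<tau><..?\<tau> + \<delta>}"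
      using \<tau>_nonneg[of "real l / 2 ^ k"] by auto
    then show "measure M (?Bad' l) \<le> r' * \<delta>"
      using prob_jump_le[OF N', of "{?\<tau><..}" "?\<tau> + \<delta>"] \<delta> by simp
  qed
  finally have "measure M ?GV \<le> measure M ?G\<tau> + (real n + 1) * (r' * \<delta>)"
    by (simp add: add.commute)
  with GA_GE GE_GV have "measure M ?GA \<le> measure M ?G\<tau> + (real n + 2) * (r' * \<delta>)"
    by (simp add: algebra_simps)
  also have "(real n + 2) * (r' * \<delta>) = e"
  proof -
    have "(real n + 2) * (r' * \<delta>) = r' * (real n + 2) * \<delta>" by simp
    also have "\<dots> = e" unfolding \<delta>_def using r' by simp
    finally show ?thesis .
  qed
  finally show "measure M ?GA \<le> measure M ?G\<tau> + e" .
qed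

text \<open>The integrand is an indicator, so the Stieltjes integral is a mass; the point 0 may be
  dropped because it has none.\<close>

lemma buffer_offline:
  assumes f: "counting_path (\<lambda>t. N' t \<omega>)" and A: "A \<in> sets borel"
    and u: "\<And>s. 0 \<le> s \<Longrightarrow> u s = indicator A s"
  shows "buffer N N' D (\<lambda>t _. u t) t \<omega> =
    D + real (N t \<omega>) + measure (jump_measure (\<lambda>t. N' t \<omega>)) (A \<inter> {0<..t}) - t"
proof -
  let ?\<kappa> = "jump_measure (\<lambda>t. N' t \<omega>)"
  have "(\<integral>\<tau>\<in>{0..t}. u \<tau> \<partial>?\<kappa>) = (\<integral>\<tau>. indicator (A \<inter> {0..t}) \<tau> \<partial>?\<kappa>)"
    unfolding set_lebesgue_integral_def
    by (intro Bochner_Integration.integral_cong refl) (auto simp: u indicator_def)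
  also have "\<dots> = measure ?\<kappa> (A \<inter> {0..t})"
    by simp
  also have "\<dots> = measure ?\<kappa> (A \<inter> {0<..t})"
  proof (rule measure_eq_AE)
    have "AE x in ?\<kappa>. x \<noteq> 0"
      by (rule AE_I[of _ _ "{0}"]) (auto simp: emeasure_jump_measure_zero[OF f])
    then show "AE x in ?\<kappa>. x \<in> A \<inter> {0..t} \<longleftrightarrow> x \<in> A \<inter> {0<..t}"
      by eventually_elim auto
  qed (use A in auto)
  finally show ?thesis by (simp add: buffer_def jump_measure_def)
qed

text \<open>
  To the right of any time the counting paths are constant for a while, so an interruption
  persists until some dyadic time.
\<close>

lemma interruption_iff_dyadic:
  fixes D :: real
  assumes f: "counting_path f" and g: "counting_path g" and A: "A \<in> sets borel"
  shows "(\<exists>t\<ge>0. D + real (f t) + measure (jump_measure g) (A \<inter> {0<..t}) - t \<le> 0) \<longleftrightarrow>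
    (\<exists>k. \<exists>l\<le>4 ^ k. D + real (f (real l / 2 ^ k)) +
      measure (jump_measure g) (A \<inter> {0<..real l / 2 ^ k}) - real l / 2 ^ k \<le> 0)"
    (is "(\<exists>t\<ge>0. ?x t \<le> 0) \<longleftrightarrow> (\<exists>k. \<exists>l\<le>4 ^ k. ?x (real l / 2 ^ k) \<le> 0)")
proof
  assume "\<exists>t\<ge>0. ?x t \<le> 0"
  then obtain t where t: "0 \<le> t" "?x t \<le> 0" by blast
  obtain d where d: "0 < d" "\<And>s. t \<le> s \<Longrightarrow> s < t + d \<Longrightarrow> f s = f t"
    using counting_path_eventually_const[OF f t(1)] by blast
  obtain d' where d': "0 < d'" "\<And>s. t \<le> s \<Longrightarrow> s < t + d' \<Longrightarrow> g s = g t"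
    using counting_path_eventually_const[OF g t(1)] by blast
  obtain i where i: "(1/2) ^ i < min d d'"
    using real_arch_pow_inv[of "min d d'" "1/2"] d d' by auto
  obtain i' where i': "t + 1 < 2 ^ i'"
    using real_arch_pow[of 2 "t + 1"] by auto
  \<comment> \<open>This \<open>k\<close> makes the mesh smaller than both intervals of constancy
    and the end \<open>2 ^ k\<close> of the grid at least \<open>t + 1\<close>.\<close>
  define k where "k = max i i'"
  \<comment> \<open>Rounding up is essential: the paths are known to be constant only to the right
    of \<open>t\<close>.\<close>
  define l where "l = nat \<lceil>t * 2 ^ k\<rceil>"
  have "(1/2::real) ^ k \<le> (1/2) ^ i"
    by (intro power_decreasing) (auto simp: k_def)
  with i have k: "1 / 2 ^ k < min d d'" by (simp add: power_divide)
  have "(2::real) ^ i' \<le> 2 ^ k"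
    by (intro power_increasing) (auto simp: k_def)
  with i' have k': "t + 1 \<le> 2 ^ k" by linarith
  have l: "t * 2 ^ k \<le> real l" "real l < t * 2 ^ k + 1"
    using t(1) by (auto simp: l_def) linarith+
  define s where "s = real l / 2 ^ k"
  have s: "t \<le> s" "s < t + 1 / 2 ^ k"
    using l by (auto simp: s_def field_simps)
  have "real l \<le> (t + 1) * 2 ^ k"
  proof -
    have "1 \<le> (2::real) ^ k" by simp
    with l(2) show ?thesis unfolding distrib_right by linarith
  qed
  also have "\<dots> \<le> 2 ^ k * 2 ^ k"
    using k' by (intro mult_right_mono) auto
  also have "\<dots> = real (4 ^ k)"
    by (simp flip: power_mult_distrib)
  finally have l_le: "l \<le> 4 ^ k" by (simp only: of_nat_le_iff)
  have "(A \<inter> {0<..t} \<union> {t<..s}) \<inter> {0<..s} = A \<inter> {0<..t} \<union> {t<..s}"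
    using s(1) t(1) by auto
  then have fin: "A \<inter> {0<..t} \<union> {t<..s} \<in> fmeasurable (jump_measure g)"
    using emeasure_jump_measure_finite[OF g, of "A \<inter> {0<..t} \<union> {t<..s}" s] A
    by (simp add: fmeasurable_def)
  \<comment> \<open>No jump occurs in \<open>{t<..s}\<close>, so the buffer changes only by the
    drift, which is downward.\<close>
  have "measure (jump_measure g) (A \<inter> {0<..s}) \<le>
      measure (jump_measure g) (A \<inter> {0<..t} \<union> {t<..s})"
    by (rule measure_mono_fmeasurable[OF _ _ fin]) (use A in auto)
  also have "\<dots> \<le> measure (jump_measure g) (A \<inter> {0<..t}) + measure (jump_measure g) {t<..s}"
    using A by (intro measure_Un_le) auto
  also have "measure (jump_measure g) {t<..s} = 0"
    using d'(2)[of s] s k t(1) by (simp add: measure_jump_measure_Ioc[OF g])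
  finally have "?x s \<le> ?x t"
    using d(2)[of s] s k by simp
  with t(2) have "?x s \<le> 0" by linarith
  with l_le show "\<exists>k. \<exists>l\<le>4 ^ k. ?x (real l / 2 ^ k) \<le> 0"
    unfolding s_def by blast
next
  assume "\<exists>k. \<exists>l\<le>4 ^ k. ?x (real l / 2 ^ k) \<le> 0"
  then obtain k l where "?x (real l / 2 ^ k) \<le> 0" by blast
  moreover have "0 \<le> real l / 2 ^ k" by simp
  ultimately show "\<exists>t\<ge>0. ?x t \<le> 0" by blast
qed

text \<open>The events of having no interruption on the grid decrease as it is refined and extended,
  and they intersect in the event of no interruption at all; continuity from above gives the
  limit.\<close>

lemma interruption_prob_limit:
  assumes N: "poisson_process M r N" and N': "poisson_process M r' N'" and A: "A \<in> sets borel"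
    and u: "\<And>s. 0 \<le> s \<Longrightarrow> u s = indicator A s"
  shows "(\<lambda>k. measure M {\<omega>\<in>space M. \<forall>l\<le>4 ^ k. real l / 2 ^ k - D < real (N (real l / 2 ^ k) \<omega>) +
      measure (jump_measure (\<lambda>t. N' t \<omega>)) (A \<inter> {0<..real l / 2 ^ k})})
    \<longlonglongrightarrow> 1 - interruption_prob M N N' (\<lambda>t _. u t) D"
proof -
  interpret prob_space M using N by (simp add: poisson_process_def)
  let ?\<kappa> = "\<lambda>\<omega>. jump_measure (\<lambda>t. N' t \<omega>)"
  define ok where "ok = (\<lambda>t \<omega>. t - D < real (N t \<omega>) + measure (?\<kappa> \<omega>) (A \<inter> {0<..t}))"
  define G where "G = (\<lambda>k. {\<omega>\<in>space M. \<forall>l\<le>4 ^ k. ok (real l / 2 ^ k) \<omega>})"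
  have [measurable]: "N (real l / 2 ^ k) \<in> measurable M (count_space UNIV)" for l k
    by (rule poisson_process_measurable[OF N]) simp
  have [measurable]: "(\<lambda>\<omega>. measure (?\<kappa> \<omega>) (A \<inter> {0<..s})) \<in> borel_measurable M" for s
    by (rule measurable_measure_jump_measure[OF N' A])
  have G: "G k \<in> sets M" for k
    unfolding G_def ok_def by measurable
  have "G (Suc k) \<subseteq> G k" for k
  proof
    fix \<omega> assume \<omega>: "\<omega> \<in> G (Suc k)"
    have "ok (real l / 2 ^ k) \<omega>" if "l \<le> 4 ^ k" for l
    proof -
      have "\<forall>l\<le>4 ^ Suc k. ok (real l / 2 ^ Suc k) \<omega>"
        using \<omega> unfolding G_def by blast
      \<comment> \<open>The time with index \<open>l\<close> has index \<open>2 * l\<close> on the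
        next grid, still in range because \<open>2 * 4 ^ k\<close> is at most
        \<open>4 ^ Suc k\<close>.\<close>
      from this[rule_format, of "2 * l"] that show ?thesis by simp
    qed
    with \<omega> show "\<omega> \<in> G k" by (simp add: G_def)
  qed
  then have "decseq G" by (rule decseq_SucI)
  then have lim: "(\<lambda>k. measure M (G k)) \<longlonglongrightarrow> measure M (\<Inter>k. G k)"
    using G by (intro finite_Lim_measure_decseq) auto
  have "(\<exists>t\<ge>0. buffer N N' D (\<lambda>t _. u t) t \<omega> \<le> 0) \<longleftrightarrow> \<omega> \<notin> (\<Inter>k. G k)" if \<omega>: "\<omega> \<in> space M" for \<omega>
  proof -
    note path = poisson_process_counting_path[OF N \<omega>] poisson_process_counting_path[OF N' \<omega>]
    have buffer: "buffer N N' D (\<lambda>t _. u t) t \<omega> =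
      D + real (N t \<omega>) + measure (?\<kappa> \<omega>) (A \<inter> {0<..t}) - t" for t
      by (rule buffer_offline[where N' = N', OF path(2) A]) (rule u)
    show ?thesis
      unfolding buffer interruption_iff_dyadic[OF path A]
      using \<omega> by (auto simp: G_def ok_def not_less algebra_simps)
  qed
  then have "{\<omega>\<in>space M. \<exists>t\<ge>0. buffer N N' D (\<lambda>t _. u t) t \<omega> \<le> 0} = space M - (\<Inter>k. G k)"
    by blast
  then have "interruption_prob M N N' (\<lambda>t _. u t) D = 1 - measure M (\<Inter>k. G k)"
    using G by (simp add: interruption_prob_def prob_compl)
  with lim show ?thesis by (simp add: G_def ok_def)
qed

section \<open>Active set and cost of an off-line policy\<close>

lemma offline_policy_active_measurable:
  assumes "offline_policy u"
  shows "{t. 0 \<le> t \<and> u t = 1} \<in> sets borel"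
proof -
  have u: "u \<in> borel_measurable (restrict_space borel {0..})"
    using assms by (simp add: offline_policy_def)
  have "u -` {1} \<inter> space (restrict_space borel {0..}) \<in> sets (restrict_space borel {0..})"
    using u by (rule measurable_sets) simp
  also have "u -` {1} \<inter> space (restrict_space borel {0..}) = {t. 0 \<le> t \<and> u t = 1}"
    by (auto simp: space_restrict_space)
  finally show ?thesis by (simp add: sets_restrict_space_iff)
qed

lemma offline_policy_eq_indicator:
  "offline_policy u \<Longrightarrow> 0 \<le> s \<Longrightarrow> u s = indicator {t. 0 \<le> t \<and> u t = 1} s"
  by (auto simp: offline_policy_def indicator_def)

lemma cost_offline:
  assumes "prob_space M" and u: "offline_policy u"
  shows "cost M (\<lambda>t _. u t) = emeasure lborel {t. 0 \<le> t \<and> u t = 1}"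
proof -
  interpret prob_space M by fact
  let ?A = "{t. 0 \<le> t \<and> u t = 1}"
  have "(\<integral>\<^sup>+t\<in>{0..}. ennreal (u t) \<partial>lborel) = (\<integral>\<^sup>+t. indicator ?A t \<partial>lborel)"
    using u by (intro nn_integral_cong) (auto simp: indicator_def offline_policy_def)
  also have "\<dots> = emeasure lborel ?A"
    using offline_policy_active_measurable[OF u] by simp
  finally show ?thesis by (simp add: cost_def emeasure_space_1)
qed

lemma offline_policy_threshold: "offline_policy (threshold ts)"
proof -
  have "threshold ts \<in> borel_measurable borel"
    unfolding threshold_def by measurable
  then show ?thesis
    by (auto simp: offline_policy_def threshold_def intro: measurable_restrict_space1)
qed

theorem theorem2:
  fixes M :: "'a measure" and N Nc :: "real \<Rightarrow> 'a \<Rightarrow> nat" and R0 Rc D \<epsilon> :: real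
  assumes "R0 > 1" and "Rc > 0"
    and "poisson_process M R0 N" and "poisson_process M Rc Nc"
    and "independent_processes M N Nc"
    and "D > 0" and "0 < \<epsilon>" and "\<epsilon> < 1"
  shows "\<forall>u. offline_policy u \<and> feasible M N Nc D \<epsilon> (\<lambda>t _. u t) \<longrightarrow>
           (\<exists>ts::ereal. 0 \<le> ts \<and>
              offline_policy (threshold ts) \<and>
              feasible M N Nc D \<epsilon> (\<lambda>t _. threshold ts t) \<and>
              cost M (\<lambda>t _. threshold ts t) \<le> cost M (\<lambda>t _. u t))"
proof (intro allI impI)
  fix u assume *: "offline_policy u \<and> feasible M N Nc D \<epsilon> (\<lambda>t _. u t)"
  then have u: "offline_policy u" and feas: "feasible M N Nc D \<epsilon> (\<lambda>t _. u t)" by auto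
  interpret prob_space M using assms(3) by (simp add: poisson_process_def)
  note N = assms(3) and Nc = assms(4)
  define A where "A = {t. 0 \<le> t \<and> u t = 1}"
  \<comment> \<open>The total active time of the given policy, possibly infinite, which is why
    thresholds are extended reals.\<close>
  define ts where "ts = enn2ereal (emeasure lborel A)"
  define A' where "A' = {t. 0 \<le> t \<and> threshold ts t = 1}"
  \<comment> \<open>This is the minimum of \<open>t\<close> and \<open>ts\<close> as a real number;
    \<open>real_of_ereal\<close> is reached only if \<open>ts\<close> is finite.\<close>
  define \<tau> where "\<tau> = (\<lambda>t. if ereal t \<le> ts then t else real_of_ereal ts)"
  have A[measurable]: "A \<in> sets borel"
    unfolding A_def by (rule offline_policy_active_measurable[OF u])
  have A'[measurable]: "A' \<in> sets borel"
    unfolding A'_def by (rule offline_policy_active_measurable[OF offline_policy_threshold])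
  have ts: "0 \<le> ts" by (simp add: ts_def)
  consider (finite) x where "0 \<le> x" "emeasure lborel A = ennreal x" "ts = ereal x"
    | (infinite) "emeasure lborel A = \<infinity>" "ts = \<infinity>"
    by (cases "emeasure lborel A" rule: ennreal_cases) (auto simp: ts_def enn2ereal_ennreal)
  note ts_cases = this

  \<comment> \<open>The active time up to \<open>t\<close> is bounded both by \<open>t\<close> and
    by the total active time.\<close>
  have \<tau>_ge: "measure lborel (A \<inter> {0<..t}) \<le> \<tau> t" if t: "0 \<le> t" for t
  proof -
    have "measure lborel (A \<inter> {0<..t}) \<le> measure lborel {0<..t}"
      using emeasure_lborel_Ioc_finite[of t]
      by (intro measure_mono_fmeasurable) (auto simp: fmeasurable_def)
    then have le_t: "measure lborel (A \<inter> {0<..t}) \<le> t" using t by simp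
    show ?thesis
    proof (cases rule: ts_cases)
      case (finite x)
      then have "measure lborel (A \<inter> {0<..t}) \<le> measure lborel A"
        by (intro measure_mono_fmeasurable) (auto simp: fmeasurable_def)
      also have "\<dots> = x" using finite by (simp add: measure_def)
      finally show ?thesis using le_t finite by (simp add: \<tau>_def)
    next
      case infinite
      then show ?thesis using le_t by (simp add: \<tau>_def)
    qed
  qed
  \<comment> \<open>For the threshold policy the active part of \<open>{0<..t}\<close> is an
    interval starting at 0, so its jumps are counted by \<open>Nc\<close> at time
    \<open>\<tau> t\<close>, without any change of law.\<close>
  have A'_\<tau>: "A' \<inter> {0<..t} = {0<..\<tau> t}" "0 \<le> \<tau> t" if "0 \<le> t" for t
    using that by (cases rule: ts_cases; auto simp: A'_def \<tau>_def threshold_def split: if_splits)+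
  have jump_A': "measure (jump_measure (\<lambda>t. Nc t \<omega>)) (A' \<inter> {0<..t}) = real (Nc (\<tau> t) \<omega>)"
    if "\<omega> \<in> space M" "0 \<le> t" for \<omega> t
    using poisson_process_counting_path[OF Nc that(1)] A'_\<tau>[OF that(2)]
    by (simp add: measure_jump_measure_Ioc counting_path_def)

  let ?G = "\<lambda>B k. {\<omega>\<in>space M. \<forall>l\<le>4 ^ k. real l / 2 ^ k - D < real (N (real l / 2 ^ k) \<omega>) +
      measure (jump_measure (\<lambda>t. Nc t \<omega>)) (B \<inter> {0<..real l / 2 ^ k})}"
  have "measure M (?G A k) \<le> measure M (?G A' k)" for k
  proof -
    have "?G A' k = {\<omega>\<in>space M. \<forall>l\<le>4 ^ k. real l / 2 ^ k - D <
        real (N (real l / 2 ^ k) \<omega>) + real (Nc (\<tau> (real l / 2 ^ k)) \<omega>)}"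
      by (intro Collect_cong conj_cong refl) (simp add: jump_A')
    then show ?thesis
      using prob_grid_le[OF N Nc assms(5) A \<tau>_ge, where n = "4 ^ k" and k = k
          and b = "\<lambda>l. real l / 2 ^ k - D"]
      by simp
  qed
  \<comment> \<open>The inequality holds on every grid and survives the limit over refining
    grids.\<close>
  then have "1 - interruption_prob M N Nc (\<lambda>t _. u t) D \<le>
      1 - interruption_prob M N Nc (\<lambda>t _. threshold ts t) D"
    using LIMSEQ_le[OF
      interruption_prob_limit[where u = u, OF N Nc A offline_policy_eq_indicator[OF u, folded A_def]]
      interruption_prob_limit[where u = "threshold ts", OF N Nc A'
        offline_policy_eq_indicator[OF offline_policy_threshold, of _ ts, folded A'_def]]]
    by blast
  with feas have "feasible M N Nc D \<epsilon> (\<lambda>t _. threshold ts t)"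
    by (simp add: feasible_def)
  moreover have "emeasure lborel A' \<le> emeasure lborel A"
  proof (cases rule: ts_cases)
    case (finite x)
    \<comment> \<open>The threshold was chosen so that the new active set has exactly the measure of
      the old one.\<close>
    then have "A' = {0..x}" by (auto simp: A'_def threshold_def)
    then show ?thesis using finite by simp
  next
    case infinite
    then show ?thesis by simp
  qed
  then have "cost M (\<lambda>t _. threshold ts t) \<le> cost M (\<lambda>t _. u t)"
    by (simp add: cost_offline prob_space_axioms u offline_policy_threshold A_def A'_def)
  ultimately show "\<exists>ts::ereal. 0 \<le> ts \<and> offline_policy (threshold ts) \<and>
      feasible M N Nc D \<epsilon> (\<lambda>t _. threshold ts t) \<and>
      cost M (\<lambda>t _. threshold ts t) \<le> cost M (\<lambda>t _. u t)"
    using ts offline_policy_threshold by blast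
qed

end
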